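(* Let $(I\times\Omega,\mathcal{V},\mathcal{Q})$ be the Fubini extension space with marginal spaces $(I,\mathcal{I},\lambda)$ and $(\Omega,\mathcal{F},\mathbb{Q})$. (Direct part.) Let $\{B^u : u\in I\}$ be an e.p.i. collection of Brownian motions on $(I\times\Omega,\mathcal{V},\mathcal{Q})$. Then the process defined by $$\mathbf{B}_t(u,\omega) := B^u_t(\omega),\qquad (u,\omega)\in I\times\Omega,\ t\ge 0,$$ is a standard Brownian motion on $(I\times\Omega,\mathcal{V},\mathcal{Q})$. (Converse part.) Let $(\mathbf{B}_t)_{t\ge 0}$ be a standard Brownian motion on $(I\times\Omega,\mathcal{V},\mathcal{Q})$ such that the family of processes $\{(\mathbf{B}_t(u,\cdot))_{t\ge 0} : u\in I\}$ is e.p.i. and its elements are identically distributed (i.e. the processes $(\mathbf{B}_t(u,\cdot))_{t\ge0}$, $u\in I$, all have the same law under $\mathbb{Q}$). Then this family forms an e.p.i. collection of Brownian motions.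
   Context: Let $I=[0,1]$. Fubini extension: given probability spaces $(I,\mathcal{I},\lambda)$ and $(\Omega,\mathcal{F},\mathbb{Q})$, a probability space $(I\times\Omega,\mathcal{V},\mathcal{Q})$ extending the product space $(I\times\Omega,\mathcal{I}\otimes\mathcal{F},\lambda\otimes\mathbb{Q})$ (i.e. $\mathcal{I}\otimes\mathcal{F}\subset\mathcal{V}$ and $\mathcal{Q}=\lambda\otimes\mathbb{Q}$ on $\mathcal{I}\otimes\mathcal{F}$) is a Fubini extension if for every $\mathcal{Q}$-integrable real-valued $\mathcal{V}$-measurable $g$: (i) $\omega\mapsto g(u,\omega)$ is integrable on $(\Omega,\mathcal{F},\mathbb{Q})$ for $\lambda$-a.e. $u$, and $u\mapsto g(u,\omega)$ is integrable on $(I,\mathcal{I},\lambda)$ for $\mathbb{Q}$-a.e. $\omega$; (ii) $u\mapsto\int_\Omega g(u,\omega)\,\mathbb{Q}(d\omega)$ and $\omega\mapsto\int_I g(u,\omega)\,\lambda(du)$ are integrable on $(I,\mathcal{I},\lambda)$ and $(\Omega,\mathcal{F},\mathbb{Q})$ respectively, and $$\int_{I\times\Omega} g\,d\mathcal{Q}=\int_I\Big(\int_\Omega g(u,\omega)\,\mathbb{Q}(d\omega)\Big)\lambda(du)=\int_\Omega\Big(\int_I g(u,\omega)\,\lambda(du)\Big)\mathbb{Q}(d\omega).$$ Throughout, $(I,\mathcal{I},\lambda)$ is an extension of the Lebesgue probability space on $[0,1]$, and $(I,\mathcal{I},\lambda)$, $(\Omega,\mathcal{F},\mathbb{Q})$,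 $(I\times\Omega,\mathcal{V},\mathcal{Q})$ are chosen (as is possible by a theorem of Sun and Zhang) so that for every measurable map $\varphi$ from $I$ to the Borel probability measures on the state space $E$ there is a $\mathcal{V}$-measurable $\Theta:I\times\Omega\to E$ with $\{\Theta(u,\cdot)\}_{u\in I}$ e.p.i. and $\Theta(u,\cdot)$ of law $\varphi(u)$ under $\mathbb{Q}$ for all $u\in I$. Essential pairwise independence (e.p.i.): a family $\{\Theta(u,\cdot):u\in I\}$ of random variables (or processes, regarded as path-valued random variables) on $(\Omega,\mathcal{F},\mathbb{Q})$ is e.p.i. if for $\lambda$-a.e. $u\in I$, $\Theta(u,\cdot)$ and $\Theta(v,\cdot)$ are independent for $\lambda$-a.e. $v\in I$. Standard Brownian motion on $(I\times\Omega,\mathcal{V},\mathcal{Q})$: a real-valued process $(\mathbf{B}_t)_{t\ge0}$ on this space such that (1) $\mathbf{B}_0=0$ $\mathcal{Q}$-a.s.; (2) for $0\le s<t$, $\mathbf{B}_t-\mathbf{B}_s\sim\mathcal{N}(0,t-s)$ under $\mathcal{Q}$; (3) for $0\le t_0<\dots<t_n$ the increments $\mathbf{B}_{t_k}-\mathbf{B}_{t_{k-1}}$, $k=1,\dots,n$, are independent under $\mathcal{Q}$; (4) $t\mapsto\mathbf{B}_t(u,\omega)$ is continuous for $\mathcal{Q}$-a.e. $(u,\omega)$. Standard Brownian motion on $(\Omega,\mathcal{F},\mathbb{Q})$ is defined in the same way. E.p.i. collection of Brownian motions: a collection $\{(B^u_t)_{t\ge0}:u\in I\}$ on $(I\times\Omega,\mathcal{V},\mathcal{Q})$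 such that (1) $(u,\omega)\mapsto B^u_t(\omega)$ is jointly ($\mathcal{V}$-)measurable for all $t$; (2) the collection is e.p.i. and, for every $u\in I$, $(B^u_t)_{t\ge0}$ is a standard Brownian motion on $(\Omega,\mathcal{F},\mathbb{Q})$.
   Formalization: Joint measurability of the collection also requires the event of continuous paths to be measurable for the completed extension (the direct part fails otherwise); in the converse, "same law" includes the probability of this event, assumed measurable for the completion of each process's space. *)

theory Defs
  imports "HOL-Probability.Probability"
begin

definition lebesgue_extension :: "real measure \<Rightarrow> bool" where
  "lebesgue_extension \<Lambda> \<longleftrightarrow>
     space \<Lambda> = {0..1} \<and>
     sets (lebesgue_on {0..1}) \<subseteq> sets \<Lambda> \<and>
     (\<forall>A\<in>sets (lebesgue_on {0..1}). emeasure \<Lambda> A = emeasure (lebesgue_on {0..1}) A)"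

definition fubini_extension :: "'i measure \<Rightarrow> 'w measure \<Rightarrow> ('i \<times> 'w) measure \<Rightarrow> bool" where
  "fubini_extension \<Lambda> \<Omega> V \<longleftrightarrow>
     prob_space \<Lambda> \<and> prob_space \<Omega> \<and> prob_space V \<and>
     space V = space \<Lambda> \<times> space \<Omega> \<and>
     sets (\<Lambda> \<Otimes>\<^sub>M \<Omega>) \<subseteq> sets V \<and>
     (\<forall>A\<in>sets (\<Lambda> \<Otimes>\<^sub>M \<Omega>). emeasure V A = emeasure (\<Lambda> \<Otimes>\<^sub>M \<Omega>) A) \<and>
     (\<forall>g :: 'i \<times> 'w \<Rightarrow> real. integrable V g \<longrightarrow>
        (AE u in \<Lambda>. integrable \<Omega> (\<lambda>\<omega>. g (u, \<omega>))) \<and>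
        (AE \<omega> in \<Omega>. integrable \<Lambda> (\<lambda>u. g (u, \<omega>))) \<and>
        integrable \<Lambda> (\<lambda>u. \<integral>\<omega>. g (u, \<omega>) \<partial>\<Omega>) \<and>
        integrable \<Omega> (\<lambda>\<omega>. \<integral>u. g (u, \<omega>) \<partial>\<Lambda>) \<and>
        (\<integral>x. g x \<partial>V) = (\<integral>u. (\<integral>\<omega>. g (u, \<omega>) \<partial>\<Omega>) \<partial>\<Lambda>) \<and>
        (\<integral>x. g x \<partial>V) = (\<integral>\<omega>. (\<integral>u. g (u, \<omega>) \<partial>\<Lambda>) \<partial>\<Omega>))"

text \<open>Essential pairwise independence of a family of random variables with values in the
  measurable space \<open>N\<close>.\<close>

definition epi :: "'i measure \<Rightarrow> 'w measure \<Rightarrow> 'b measure \<Rightarrow> ('i \<Rightarrow> 'w \<Rightarrow> 'b) \<Rightarrow> bool" where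
  "epi \<Lambda> \<Omega> N \<Theta> \<longleftrightarrow>
     (\<forall>u\<in>space \<Lambda>. \<Theta> u \<in> \<Omega> \<rightarrow>\<^sub>M N) \<and>
     (AE u in \<Lambda>. AE v in \<Lambda>. prob_space.indep_var \<Omega> N (\<Theta> u) N (\<Theta> v))"

text \<open>The richness property of the Sun--Zhang construction, for the Polish state space \<open>'e\<close>.\<close>

definition rich_for ::
    "'e::polish_space itself \<Rightarrow> 'i measure \<Rightarrow> 'w measure \<Rightarrow> ('i \<times> 'w) measure \<Rightarrow> bool" where
  "rich_for E \<Lambda> \<Omega> V \<longleftrightarrow>
     (\<forall>\<phi> \<in> \<Lambda> \<rightarrow>\<^sub>M prob_algebra (borel :: 'e measure).
        \<exists>\<Theta> \<in> V \<rightarrow>\<^sub>M (borel :: 'e measure).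
          epi \<Lambda> \<Omega> borel (\<lambda>u \<omega>. \<Theta> (u, \<omega>)) \<and>
          (\<forall>u\<in>space \<Lambda>. distr \<Omega> borel (\<lambda>\<omega>. \<Theta> (u, \<omega>)) = \<phi> u))"

definition standard_BM :: "'a measure \<Rightarrow> (real \<Rightarrow> 'a \<Rightarrow> real) \<Rightarrow> bool" where
  "standard_BM M X \<longleftrightarrow>
     (\<forall>t\<ge>0. X t \<in> borel_measurable M) \<and>
     (AE x in M. X 0 x = 0) \<and>
     (\<forall>s t. 0 \<le> s \<and> s < t \<longrightarrow>
        distributed M lborel (\<lambda>x. X t x - X s x) (normal_density 0 (sqrt (t - s)))) \<and>
     (\<forall>(n::nat) \<tau>. 0 \<le> \<tau> 0 \<and> (\<forall>k<n. \<tau> k < \<tau> (Suc k)) \<longrightarrow>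
        prob_space.indep_vars M (\<lambda>_. borel) (\<lambda>k x. X (\<tau> (Suc k)) x - X (\<tau> k) x) {..<n}) \<and>
     (AE x in M. continuous_on {0..} (\<lambda>t. X t x))"

text \<open>Processes as path-valued random variables.  The cylinder \<open>\<sigma>\<close>-algebra \<open>cylinder_space\<close> on
  all functions on \<open>[0,\<infinity>)\<close> is the one generated by the coordinates, and independence of
  processes refers to it.  It does not contain the set of continuous paths, so a law on it cannot
  tell whether a process has continuous paths.  Laws of processes are therefore taken on
  \<open>path_space\<close>, where the set of continuous paths is adjoined to the cylinder sets.  As continuity
  is only ever required almost surely, the corresponding event has to be measurable only with
  respect to the completion; for a process whose paths are almost surely continuous this
  is automatic (\<open>processI\<close>).\<close>

definition cylinder_space :: "(real \<Rightarrow> real) measure" where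
  "cylinder_space = PiM {0..} (\<lambda>_. borel)"

definition path_space :: "(real \<Rightarrow> real) measure" where
  "path_space = sigma (space cylinder_space)
     (sets cylinder_space \<union> {{p \<in> space cylinder_space. continuous_on {0..} p}})"

definition sample_path :: "(real \<Rightarrow> 'a \<Rightarrow> real) \<Rightarrow> 'a \<Rightarrow> real \<Rightarrow> real" where
  "sample_path X x = (\<lambda>t\<in>{0..}. X t x)"

definition process :: "'a measure \<Rightarrow> (real \<Rightarrow> 'a \<Rightarrow> real) \<Rightarrow> bool" where
  "process M X \<longleftrightarrow>
     (\<forall>t\<ge>0. X t \<in> borel_measurable M) \<and> sample_path X \<in> completion M \<rightarrow>\<^sub>M path_space"

definition path_law :: "'a measure \<Rightarrow> (real \<Rightarrow> 'a \<Rightarrow> real) \<Rightarrow> (real \<Rightarrow> real) measure" where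
  "path_law M X = distr (completion M) path_space (sample_path X)"

lemma process_iff:
  "process M X \<longleftrightarrow> (\<forall>t\<ge>0. X t \<in> borel_measurable M) \<and>
     {x \<in> space M. continuous_on {0..} (\<lambda>t. X t x)} \<in> sets (completion M)"
proof -
  let ?C = "{p \<in> space cylinder_space. continuous_on {0..} p}"
  have sp: "space cylinder_space = extensional {0..}"
    by (simp add: cylinder_space_def space_PiM PiE_def)
  have path_in: "sample_path X x \<in> space cylinder_space" for x
    by (simp add: sp sample_path_def)
  have sub: "sets cylinder_space \<union> {?C} \<subseteq> Pow (space cylinder_space)"
    using sets.sets_into_space by blast
  have spp: "space path_space = space cylinder_space"
    using sub by (simp add: path_space_def)
  have Cin: "?C \<in> sets path_space"
    using sub by (simp add: path_space_def sets_measure_of)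
  have "continuous_on {0..} (sample_path X x) \<longleftrightarrow> continuous_on {0..} (\<lambda>t. X t x)" for x
    by (rule continuous_on_cong) (auto simp: sample_path_def)
  then have vim: "sample_path X -` ?C \<inter> space M = {x \<in> space M. continuous_on {0..} (\<lambda>t. X t x)}"
    using path_in by auto
  show ?thesis
  proof (intro iffI conjI)
    assume "process M X"
    then show "\<forall>t\<ge>0. X t \<in> borel_measurable M" by (simp add: process_def)
    from \<open>process M X\<close> have "sample_path X \<in> completion M \<rightarrow>\<^sub>M path_space" by (simp add: process_def)
    from measurable_sets[OF this Cin]
    show "{x \<in> space M. continuous_on {0..} (\<lambda>t. X t x)} \<in> sets (completion M)"
      using vim by simp
  next
    assume *: "(\<forall>t\<ge>0. X t \<in> borel_measurable M) \<and>
      {x \<in> space M. continuous_on {0..} (\<lambda>t. X t x)} \<in> sets (completion M)"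
    have cyl: "sample_path X \<in> completion M \<rightarrow>\<^sub>M cylinder_space"
      unfolding cylinder_space_def sample_path_def
      using * by (intro measurable_restrict measurable_completion) auto
    have "sample_path X \<in> completion M \<rightarrow>\<^sub>M path_space"
      unfolding path_space_def
    proof (rule measurable_measure_of[OF sub])
      show "sample_path X \<in> space (completion M) \<rightarrow> space cylinder_space"
        using path_in by auto
    next
      fix A assume "A \<in> sets cylinder_space \<union> {?C}"
      then show "sample_path X -` A \<inter> space (completion M) \<in> sets (completion M)"
        using measurable_sets[OF cyl, of A] vim * by auto
    qed
    with * show "process M X" by (simp add: process_def)
  qed
qed

lemma processI:
  assumes "\<And>t. t \<ge> 0 \<Longrightarrow> X t \<in> borel_measurable M"
    and "AE x in M. continuous_on {0..} (\<lambda>t. X t x)"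
  shows "process M X"
proof -
  let ?D = "{x \<in> space M. continuous_on {0..} (\<lambda>t. X t x)}"
  obtain N where N: "N \<in> null_sets M" "{x \<in> space M. x \<notin> ?D} \<subseteq> N"
    using assms(2) by (auto elim!: AE_E simp: null_sets_def)
  then have "space M - ?D \<in> sets (completion M)"
    by (intro sets_completionI_sub[of N]) auto
  then have "space (completion M) - (space M - ?D) \<in> sets (completion M)"
    by (intro sets.compl_sets)
  moreover have "space (completion M) - (space M - ?D) = ?D" by auto
  ultimately show ?thesis using assms(1) by (simp add: process_iff)
qed

definition epi_processes :: "'i measure \<Rightarrow> 'w measure \<Rightarrow> ('i \<Rightarrow> real \<Rightarrow> 'w \<Rightarrow> real) \<Rightarrow> bool" where
  "epi_processes \<Lambda> \<Omega> X \<longleftrightarrow> epi \<Lambda> \<Omega> cylinder_space (\<lambda>u. sample_path (X u))"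

definition identically_distributed_processes ::
    "'i measure \<Rightarrow> 'w measure \<Rightarrow> ('i \<Rightarrow> real \<Rightarrow> 'w \<Rightarrow> real) \<Rightarrow> bool" where
  "identically_distributed_processes \<Lambda> \<Omega> X \<longleftrightarrow>
     (\<forall>u\<in>space \<Lambda>. process \<Omega> (X u)) \<and>
     (\<forall>u\<in>space \<Lambda>. \<forall>v\<in>space \<Lambda>. path_law \<Omega> (X u) = path_law \<Omega> (X v))"

text \<open>Joint measurability is that of the path-valued map \<open>(u, \<omega>) \<mapsto> (X u t \<omega>)\<^sub>t\<close>; \<open>process\<close> contains
  the joint measurability of \<open>(u, \<omega>) \<mapsto> X u t \<omega>\<close> for each \<open>t\<close>.  The latter alone is not enough:
  changing \<open>X u\<close> at the single time \<open>t = u\<close> on a \<open>u\<close>-dependent null event \<open>A u\<close> keeps each map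
  \<open>(u, \<omega>) \<mapsto> X u t \<omega>\<close> measurable, but the pairs \<open>(u, \<omega>)\<close> with \<open>\<omega> \<in> A u\<close> may have outer measure one.\<close>

definition epi_BM_collection ::
    "'i measure \<Rightarrow> 'w measure \<Rightarrow> ('i \<times> 'w) measure \<Rightarrow> ('i \<Rightarrow> real \<Rightarrow> 'w \<Rightarrow> real) \<Rightarrow> bool" where
  "epi_BM_collection \<Lambda> \<Omega> V X \<longleftrightarrow>
     process V (\<lambda>t (u, \<omega>). X u t \<omega>) \<and>
     epi_processes \<Lambda> \<Omega> X \<and>
     (\<forall>u\<in>space \<Lambda>. standard_BM \<Omega> (X u))"

end

theory Submission
  imports Defs
begin

text \<open>Integrating indicators, the Fubini property turns probabilities under the extended product
  measure into averages of probabilities of sections.  Hence, if every section of a random variable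
  has the same law, this is also its law on the extension.  Being a standard Brownian motion
  depends only on the laws of finite vectors of increments and on almost sure continuity of the
  paths, so that it passes between the extension and the sections in both directions.\<close>

section \<open>Sections of events and of laws under a Fubini extension\<close>

lemma fubini_extension_prob_spaces:
  assumes "fubini_extension \<Lambda> \<Omega> V"
  shows "prob_space \<Lambda>" "prob_space \<Omega>" "prob_space V" "space V = space \<Lambda> \<times> space \<Omega>"
  using assms by (auto simp: fubini_extension_def)

text \<open>The Fubini property is applied to the indicator of \<open>A\<close>. It controls
  sections only almost everywhere, hence the separate third claim that almost every
  \<open>S u\<close> is an event.\<close>

lemma fubini_extension_indicator:
  assumes F: "fubini_extension \<Lambda> \<Omega> V" and A: "A \<in> sets V"
  defines "S \<equiv> \<lambda>u. {\<omega> \<in> space \<Omega>. (u, \<omega>) \<in> A}"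
  shows "measure V A = (\<integral>u. measure \<Omega> (S u) \<partial>\<Lambda>)"
    and "integrable \<Lambda> (\<lambda>u. measure \<Omega> (S u))"
    and "AE u in \<Lambda>. S u \<in> sets \<Omega>"
proof -
  interpret prob_space V by (rule fubini_extension_prob_spaces[OF F])
  have AV: "A \<inter> space V = A" using sets.sets_into_space[OF A] by auto
  \<comment> \<open>This needs no measurability of \<open>S u\<close>: for a non-measurable section
    the Bochner integral and \<open>measure\<close> are both 0 by convention. Hence it can be
    rewritten for all \<open>u\<close> at once.\<close>
  have ind: "(\<integral>\<omega>. indicat_real A (u, \<omega>) \<partial>\<Omega>) = measure \<Omega> (S u)" for u
  proof -
    have "(\<integral>\<omega>. indicat_real A (u, \<omega>) \<partial>\<Omega>) = (\<integral>\<omega>. indicat_real (S u) \<omega> \<partial>\<Omega>)"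
      by (rule Bochner_Integration.integral_cong) (auto simp: S_def indicator_def)
    also have "\<dots> = measure \<Omega> (S u \<inter> space \<Omega>)" by (rule Bochner_Integration.integral_indicator)
    also have "S u \<inter> space \<Omega> = S u" by (auto simp: S_def)
    finally show ?thesis .
  qed
  have "integrable V (indicat_real A)"
    using A by (intro integrable_real_indicator) (simp_all add: emeasure_eq_measure)
  then have *: "AE u in \<Lambda>. integrable \<Omega> (\<lambda>\<omega>. indicat_real A (u, \<omega>))"
    "integrable \<Lambda> (\<lambda>u. \<integral>\<omega>. indicat_real A (u, \<omega>) \<partial>\<Omega>)"
    "(\<integral>x. indicat_real A x \<partial>V) = (\<integral>u. (\<integral>\<omega>. indicat_real A (u, \<omega>) \<partial>\<Omega>) \<partial>\<Lambda>)"
    using F[unfolded fubini_extension_def] by auto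
  show "measure V A = (\<integral>u. measure \<Omega> (S u) \<partial>\<Lambda>)" "integrable \<Lambda> (\<lambda>u. measure \<Omega> (S u))"
    using *(2,3) AV unfolding ind by simp_all
  show "AE u in \<Lambda>. S u \<in> sets \<Omega>"
    using *(1)
  proof eventually_elim
    case (elim u)
    then have [measurable]: "(\<lambda>\<omega>. indicat_real A (u, \<omega>)) \<in> borel_measurable \<Omega>"
      by (rule borel_measurable_integrable)
    \<comment> \<open>The section is recovered as the level set at 1 of its measurable
      indicator.\<close>
    have "{\<omega> \<in> space \<Omega>. indicat_real A (u, \<omega>) = 1} \<in> sets \<Omega>" by measurable
    then show ?case by (simp add: S_def indicator_eq_1_iff)
  qed
qed

text \<open>For each event of \<open>N\<close> the section probabilities are constant in
  \<open>u\<close>, and averaging a constant over a probability measure returns it. This one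
  principle serves both directions of the theorem.\<close>

lemma fubini_extension_distr_eq:
  assumes F: "fubini_extension \<Lambda> \<Omega> V"
    and Y: "Y \<in> V \<rightarrow>\<^sub>M N"
    and sec: "\<And>u. u \<in> space \<Lambda> \<Longrightarrow> (\<lambda>\<omega>. Y (u, \<omega>)) \<in> \<Omega> \<rightarrow>\<^sub>M N"
    and law: "\<And>u. u \<in> space \<Lambda> \<Longrightarrow> distr \<Omega> N (\<lambda>\<omega>. Y (u, \<omega>)) = \<mu>"
  shows "distr V N Y = \<mu>"
proof -
  note prob = fubini_extension_prob_spaces[OF F]
  interpret L: prob_space \<Lambda> by (rule prob)
  interpret W: prob_space \<Omega> by (rule prob)
  interpret V: prob_space V by (rule prob)
  obtain v where v: "v \<in> space \<Lambda>" using L.not_empty by auto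
  show ?thesis
  proof (rule measure_eqI)
    show "sets (distr V N Y) = sets \<mu>" using law[OF v] by auto
  next
    fix A assume "A \<in> sets (distr V N Y)"
    then have A: "A \<in> sets N" by simp
    have "measure \<Omega> {\<omega> \<in> space \<Omega>. (u, \<omega>) \<in> Y -` A \<inter> space V} = measure \<mu> A"
      if u: "u \<in> space \<Lambda>" for u
    proof -
      have "{\<omega> \<in> space \<Omega>. (u, \<omega>) \<in> Y -` A \<inter> space V} = (\<lambda>\<omega>. Y (u, \<omega>)) -` A \<inter> space \<Omega>"
        using u prob(4) by auto
      then show ?thesis
        using law[OF u] measure_distr[OF sec[OF u] A] by simp
    qed
    then have "measure V (Y -` A \<inter> space V) = (\<integral>u. measure \<mu> A \<partial>\<Lambda>)"
      unfolding fubini_extension_indicator(1)[OF F measurable_sets[OF Y A]]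
      by (intro Bochner_Integration.integral_cong) auto
    then have "measure (distr V N Y) A = measure \<mu> A"
      using L.prob_space by (simp add: measure_distr[OF Y A])
    moreover have "prob_space \<mu>" using W.prob_space_distr[OF sec[OF v]] law[OF v] by simp
    ultimately show "emeasure (distr V N Y) A = emeasure \<mu> A"
      using V.prob_space_distr[OF Y]
      by (simp add: prob_space.finite_measure finite_measure.emeasure_eq_measure)
  qed
qed

text \<open>A null event has a nonnegative function of \<open>u\<close>, the measure of its
  sections, with integral 0, so almost all of its sections are null.\<close>

lemma fubini_extension_AE_sections:
  assumes F: "fubini_extension \<Lambda> \<Omega> V" and P: "AE x in V. P x"
  shows "AE u in \<Lambda>. AE \<omega> in \<Omega>. P (u, \<omega>)"
proof -
  note prob = fubini_extension_prob_spaces[OF F]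
  interpret W: prob_space \<Omega> by (rule prob)
  obtain A where A: "{x \<in> space V. \<not> P x} \<subseteq> A" "A \<in> sets V" "emeasure V A = 0"
    using P by (auto elim: AE_E)
  have "(\<integral>u. measure \<Omega> {\<omega> \<in> space \<Omega>. (u, \<omega>) \<in> A} \<partial>\<Lambda>) = 0"
    using fubini_extension_indicator(1)[OF F A(2)] A(3) by (simp add: measure_def)
  then have "AE u in \<Lambda>. measure \<Omega> {\<omega> \<in> space \<Omega>. (u, \<omega>) \<in> A} = 0"
    using fubini_extension_indicator(2)[OF F A(2)]
    by (subst (asm) integral_nonneg_eq_0_iff_AE) auto
  with fubini_extension_indicator(3)[OF F A(2)] AE_space show ?thesis
  proof eventually_elim
    case (elim u)
    then show ?case
      using A(1) prob(4) by (intro AE_I[of _ _ "{\<omega> \<in> space \<Omega>. (u, \<omega>) \<in> A}"])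
        (auto simp: W.emeasure_eq_measure)
  qed
qed

text \<open>Null sections force a null set once the set is measurable for the completion: up to a
  null part it is a \<open>V\<close>-event, to which the averaging formula applies. The completion
  is allowed because path continuity is measurable only there.\<close>

lemma fubini_extension_AE_I:
  assumes F: "fubini_extension \<Lambda> \<Omega> V"
    and meas: "{x \<in> space V. P x} \<in> sets (completion V)"
    and P: "\<And>u. u \<in> space \<Lambda> \<Longrightarrow> AE \<omega> in \<Omega>. P (u, \<omega>)"
  shows "AE x in V. P x"
proof -
  note prob = fubini_extension_prob_spaces[OF F]
  interpret V: prob_space V by (rule prob)
  let ?C = "{x \<in> space V. \<not> P x}"
  have "space (completion V) - {x \<in> space V. P x} \<in> sets (completion V)"
    using meas by (rule sets.compl_sets)
  also have "space (completion V) - {x \<in> space V. P x} = ?C" by auto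
  finally have C: "?C \<in> sets (completion V)" .
  \<comment> \<open>\<open>main_part\<close> is an inner approximation: an event of \<open>V\<close>
    inside \<open>?C\<close> whose measure is the completed measure of \<open>?C\<close>. Being a
    subset, it inherits the null sections.\<close>
  define S where "S = main_part V ?C"
  have S: "S \<in> sets V" "S \<subseteq> ?C"
    using C main_part_null_part_Un[OF C] unfolding S_def by (simp, blast)
  have "measure \<Omega> {\<omega> \<in> space \<Omega>. (u, \<omega>) \<in> S} = 0" if u: "u \<in> space \<Lambda>" for u
  \<comment> \<open>A section of \<open>S\<close> may fail to be an event of
    \<open>\<Omega>\<close>; then \<open>measure\<close> is 0 by convention.\<close>
  proof (cases "{\<omega> \<in> space \<Omega>. (u, \<omega>) \<in> S} \<in> sets \<Omega>")
    case True
    have "AE \<omega> in \<Omega>. \<omega> \<notin> {\<omega> \<in> space \<Omega>. (u, \<omega>) \<in> S}"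
      using P[OF u] by eventually_elim (use S(2) in auto)
    with True have "{\<omega> \<in> space \<Omega>. (u, \<omega>) \<in> S} \<in> null_sets \<Omega>"
      by (simp add: AE_iff_null_sets)
    then show ?thesis by (simp add: measure_def null_setsD1)
  qed (rule measure_notin_sets)
  then have "(\<integral>u. measure \<Omega> {\<omega> \<in> space \<Omega>. (u, \<omega>) \<in> S} \<partial>\<Lambda>) = (\<integral>u. 0 \<partial>\<Lambda>)"
    by (intro Bochner_Integration.integral_cong) auto
  then have "measure V S = 0"
    using fubini_extension_indicator(1)[OF F S(1)] by simp
  then have "emeasure (completion V) ?C = 0"
    using C by (simp add: emeasure_completion S_def V.emeasure_eq_measure)
  then have "AE x in completion V. P x"
    using C by (intro AE_I[of _ _ ?C]) auto
  then show ?thesis by (simp add: AE_completion_iff)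
qed

section \<open>Brownian motion in terms of joint laws of increments\<close>

text \<open>A grid carries \<open>n\<close> increments between \<open>n + 1\<close> times. The case
  \<open>n = 0\<close> is excluded because the product-law criterion for independence asks for a
  nonempty index set.\<close>

definition time_grid :: "nat \<Rightarrow> (nat \<Rightarrow> real) \<Rightarrow> bool" where
  "time_grid n \<tau> \<longleftrightarrow> 0 < n \<and> 0 \<le> \<tau> 0 \<and> (\<forall>k<n. \<tau> k < \<tau> (Suc k))"

definition increments :: "nat \<Rightarrow> (nat \<Rightarrow> real) \<Rightarrow> (real \<Rightarrow> 'a \<Rightarrow> real) \<Rightarrow> 'a \<Rightarrow> nat \<Rightarrow> real" where
  "increments n \<tau> X x = (\<lambda>k\<in>{..<n}. X (\<tau> (Suc k)) x - X (\<tau> k) x)"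

text \<open>The centred Gaussian law with variance \<open>v\<close>; the square root converts to the
  standard deviation that \<open>normal_density\<close> takes.\<close>

definition normal_measure :: "real \<Rightarrow> real measure" where
  "normal_measure v = density lborel (normal_density 0 (sqrt v))"

definition increments_law :: "nat \<Rightarrow> (nat \<Rightarrow> real) \<Rightarrow> (nat \<Rightarrow> real) measure" where
  "increments_law n \<tau> = (\<Pi>\<^sub>M k\<in>{..<n}. normal_measure (\<tau> (Suc k) - \<tau> k))"

lemma sets_normal_measure [measurable_cong]: "sets (normal_measure v) = sets borel"
  by (simp add: normal_measure_def)

lemma prob_space_normal_measure: "0 < v \<Longrightarrow> prob_space (normal_measure v)"
  unfolding normal_measure_def by (rule prob_space_normal_density) simp

lemma time_grid_nonneg:
  assumes "time_grid n \<tau>" "k \<le> n"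
  shows "0 \<le> \<tau> k"
  using assms(2)
proof (induction k)
  case (Suc k)
  then have "0 \<le> \<tau> k" "\<tau> k < \<tau> (Suc k)" using assms(1) by (auto simp: time_grid_def)
  then show ?case by simp
qed (use assms(1) in \<open>simp add: time_grid_def\<close>)

lemma increment_measurable:
  fixes X :: "real \<Rightarrow> 'a \<Rightarrow> real"
  assumes "\<And>t. 0 \<le> t \<Longrightarrow> X t \<in> borel_measurable M" "time_grid n \<tau>" "k < n"
  shows "(\<lambda>x. X (\<tau> (Suc k)) x - X (\<tau> k) x) \<in> borel_measurable M"
  using assms(3) by (intro borel_measurable_diff assms(1) time_grid_nonneg[OF assms(2)]) auto

lemma increments_measurable:
  assumes "\<And>t. 0 \<le> t \<Longrightarrow> X t \<in> borel_measurable M" "time_grid n \<tau>"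
  shows "increments n \<tau> X \<in> M \<rightarrow>\<^sub>M PiM {..<n} (\<lambda>_. borel)"
  unfolding increments_def
  by (rule measurable_restrict) (use increment_measurable[OF assms] in auto)

lemma distributed_normal_iff:
  assumes "X \<in> borel_measurable M"
  shows "distributed M lborel X (normal_density 0 (sqrt v)) \<longleftrightarrow>
    distr M borel X = normal_measure v"
proof -
  have "distr M lborel X = distr M borel X" by (rule distr_cong) auto
  then show ?thesis using assms by (simp add: distributed_def normal_measure_def)
qed

text \<open>A probability law on the line concentrated at a point is the Dirac measure there. This
  turns the initial condition into an equation between laws.\<close>

lemma AE_eq_iff_distr_return:
  assumes "prob_space M" and X [measurable]: "X \<in> borel_measurable M"
  shows "(AE x in M. X x = c) \<longleftrightarrow> distr M borel X = return borel (c :: real)"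
proof
  interpret prob_space M by fact
  assume "AE x in M. X x = c"
  then have "AE y in distr M borel X. y = c" by (subst AE_distr_iff) auto
  then have "distr M borel X = return (distr M borel X) c"
    by (intro prob_space.AE_eq_constD prob_space_distr X)
  also have "\<dots> = return borel c" by (rule return_cong) simp
  finally show "distr M borel X = return borel c" .
next
  assume eq: "distr M borel X = return borel c"
  have "AE y in distr M borel X. y = c"
    unfolding eq by (subst AE_return) auto
  then show "AE x in M. X x = c" by (subst (asm) AE_distr_iff) auto
qed

lemma distr_PiM_coordinate:
  assumes "Y \<in> M \<rightarrow>\<^sub>M PiM I (\<lambda>_. borel)" "k \<in> I"
  shows "distr M borel (\<lambda>x. Y x k) = distr (distr M (PiM I (\<lambda>_. borel)) Y) borel (\<lambda>p. p k)"
  using assms by (subst distr_distr) (auto simp: comp_def)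

text \<open>Normality and independence merge into one condition, a product of Gaussians as joint law
  of the increments over each grid. All clauses except measurability and continuity then have the
  form that \<open>fubini_extension_distr_eq\<close> handles.\<close>

lemma standard_BM_iff_increments:
  assumes "prob_space M"
  shows "standard_BM M X \<longleftrightarrow>
    (\<forall>t\<ge>0. X t \<in> borel_measurable M) \<and>
    distr M borel (X 0) = return borel 0 \<and>
    (\<forall>n \<tau>. time_grid n \<tau> \<longrightarrow>
      distr M (PiM {..<n} (\<lambda>_. borel)) (increments n \<tau> X) = increments_law n \<tau>) \<and>
    (AE x in M. continuous_on {0..} (\<lambda>t. X t x))"
    (is "_ \<longleftrightarrow> ?meas \<and> ?zero \<and> ?incr \<and> ?cont")
proof (cases ?meas)
  case meas: True
  interpret prob_space M by fact
  let ?d = "\<lambda>\<tau> k x. X (\<tau> (Suc k)) x - X (\<tau> k) x"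
  let ?normal = "\<lambda>s t. distributed M lborel (\<lambda>x. X t x - X s x) (normal_density 0 (sqrt (t - s)))"
  have normal_iff: "?normal s t \<longleftrightarrow> distr M borel (\<lambda>x. X t x - X s x) = normal_measure (t - s)"
    if "0 \<le> s" "s < t" for s t
    using meas that by (intro distributed_normal_iff borel_measurable_diff) auto
  have zero_iff: "(AE x in M. X 0 x = 0) \<longleftrightarrow> ?zero"
    using meas by (intro AE_eq_iff_distr_return prob_space_axioms) auto
  have indep_iff: "indep_vars (\<lambda>_. borel) (?d \<tau>) {..<n} \<longleftrightarrow>
      distr M (PiM {..<n} (\<lambda>_. borel)) (increments n \<tau> X) =
      (\<Pi>\<^sub>M k\<in>{..<n}. distr M borel (?d \<tau> k))"
    if "time_grid n \<tau>" for n \<tau>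
    unfolding increments_def
    using that meas
    by (intro indep_vars_iff_distr_eq_PiM' increment_measurable) (auto simp: time_grid_def)
  have law_iff: "(\<Pi>\<^sub>M k\<in>{..<n}. distr M borel (?d \<tau> k)) = increments_law n \<tau>"
    if "time_grid n \<tau>" and *: "\<And>s t. 0 \<le> s \<Longrightarrow> s < t \<Longrightarrow> ?normal s t" for n \<tau>
    unfolding increments_law_def
  proof (intro PiM_cong refl)
    fix k assume "k \<in> {..<n}"
    then have "0 \<le> \<tau> k" "\<tau> k < \<tau> (Suc k)"
      using time_grid_nonneg[OF that(1), of k] that(1) by (auto simp: time_grid_def)
    then show "distr M borel (?d \<tau> k) = normal_measure (\<tau> (Suc k) - \<tau> k)"
      using * normal_iff by blast
  qed
  have "?normal s t" if incr: ?incr and st: "0 \<le> s" "s < t" for s t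
  proof -
    \<comment> \<open>The grid consisting of \<open>s\<close> and \<open>t\<close> alone: its only
      increment is the one wanted, and values of \<open>\<tau>\<close> beyond index 1 are never
      read.\<close>
    define \<tau> where "\<tau> k = (case k of 0 \<Rightarrow> s | Suc _ \<Rightarrow> t)" for k :: nat
    have grid: "time_grid 1 \<tau>" using st by (auto simp: time_grid_def \<tau>_def)
    have "distr M borel (\<lambda>x. X t x - X s x) = distr M borel (\<lambda>x. increments 1 \<tau> X x 0)"
      by (simp add: increments_def \<tau>_def)
    also have "\<dots> = distr (increments_law 1 \<tau>) borel (\<lambda>p. p 0)"
      using incr grid increments_measurable[OF _ grid] meas
      by (subst distr_PiM_coordinate[where I = "{..<1}"]) auto
    \<comment> \<open>The target is replaced by a measure with the same events, since
      \<open>distr_PiM_component\<close> pushes forward to the factor measure itself.\<close>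
    also have "\<dots> = distr (increments_law 1 \<tau>) (normal_measure (t - s)) (\<lambda>p. p 0)"
      by (rule distr_cong) (auto simp: sets_normal_measure)
    also have "\<dots> = normal_measure (t - s)"
      using distr_PiM_component[of "{..<1}" "\<lambda>k. normal_measure (\<tau> (Suc k) - \<tau> k)" 0] st
      by (simp add: increments_law_def prob_space_normal_measure \<tau>_def)
    finally show ?thesis using normal_iff st by blast
  qed
  \<comment> \<open>If all increments are normal, \<open>indep_iff\<close> and
    \<open>law_iff\<close> match the two sides grid by grid. If some increment is not, the right
    side fails too, because \<open>?incr\<close> implies normality.\<close>
  then have "(\<forall>s t. 0 \<le> s \<and> s < t \<longrightarrow> ?normal s t) \<and>
      (\<forall>n \<tau>. time_grid n \<tau> \<longrightarrow> indep_vars (\<lambda>_. borel) (?d \<tau>) {..<n}) \<longleftrightarrow> ?incr"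
  proof (cases "\<forall>s t. 0 \<le> s \<and> s < t \<longrightarrow> ?normal s t")
    case True
    then show ?thesis by (auto simp: indep_iff law_iff)
  qed blast
  moreover have "(\<forall>n \<tau>. time_grid n \<tau> \<longrightarrow> indep_vars (\<lambda>_. borel) (?d \<tau>) {..<n}) \<longleftrightarrow>
      (\<forall>n \<tau>. 0 \<le> \<tau> 0 \<and> (\<forall>k<n. \<tau> k < \<tau> (Suc k)) \<longrightarrow> indep_vars (\<lambda>_. borel) (?d \<tau>) {..<n})"
  proof -
    \<comment> \<open>Independence over the empty index set is vacuous, so requiring
      \<open>0 < n\<close> in \<open>time_grid\<close> loses nothing.\<close>
    have "indep_vars (\<lambda>_. borel) (?d \<tau>) {..<n}" if "\<not> 0 < n" for n \<tau>
      using that by (simp add: indep_vars_def2 indep_sets_def)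
    then show ?thesis unfolding time_grid_def by blast
  qed
  ultimately show ?thesis
    using meas zero_iff unfolding standard_BM_def by blast
qed (unfold standard_BM_def, blast)

section \<open>What the law on path space determines\<close>

lemma sets_cylinder_space_subset_path_space: "sets cylinder_space \<subseteq> sets path_space"
  and space_path_space: "space path_space = space cylinder_space"
  and continuous_paths_in_path_space:
    "{p \<in> space path_space. continuous_on {0..} p} \<in> sets path_space"
proof -
  let ?C = "{p \<in> space cylinder_space. continuous_on {0..} p}"
  have sub: "sets cylinder_space \<union> {?C} \<subseteq> Pow (space cylinder_space)"
    using sets.sets_into_space by blast
  show *: "space path_space = space cylinder_space"
    using sub by (simp add: path_space_def)
  show "sets cylinder_space \<subseteq> sets path_space" 
    "{p \<in> space path_space. continuous_on {0..} p} \<in> sets path_space"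
    unfolding * using sub by (auto simp: path_space_def)
qed

lemma coordinate_measurable_path_space:
  assumes "0 \<le> t"
  shows "(\<lambda>p. p t) \<in> borel_measurable path_space"
proof -
  have "(\<lambda>p. p t) \<in> borel_measurable cylinder_space"
    unfolding cylinder_space_def using assms by (intro measurable_component_singleton) auto
  then show ?thesis
    using sets_cylinder_space_subset_path_space space_path_space
    by (auto simp: measurable_def)
qed

text \<open>\<open>path_law\<close> lives on the completion. The third assumption puts the preimages
  into \<open>M\<close> itself, where the completed measure agrees with \<open>M\<close>.\<close>

lemma path_law_functional:
  assumes "process M X" "F \<in> path_space \<rightarrow>\<^sub>M N" and "(\<lambda>x. F (sample_path X x)) \<in> M \<rightarrow>\<^sub>M N"
  shows "distr M N (\<lambda>x. F (sample_path X x)) = distr (path_law M X) N F"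
proof -
  have "distr M N (\<lambda>x. F (sample_path X x)) = distr (completion M) N (\<lambda>x. F (sample_path X x))"
    using assms(3) by (rule distr_completion[symmetric])
  also have "\<dots> = distr (path_law M X) N F"
    using assms(1,2) by (simp add: path_law_def process_def distr_distr comp_def)
  finally show ?thesis .
qed

text \<open>Almost sure continuity is a property of the law because the set of continuous paths is
  an event of \<open>path_space\<close>; passing to the completion does not change almost sure
  statements.\<close>

lemma AE_continuous_iff_path_law:
  assumes "process M X"
  shows "(AE x in M. continuous_on {0..} (\<lambda>t. X t x)) \<longleftrightarrow>
    (AE p in path_law M X. continuous_on {0..} p)"
proof -
  have "continuous_on {0..} (sample_path X x) \<longleftrightarrow> continuous_on {0..} (\<lambda>t. X t x)" for x
    by (rule continuous_on_cong) (auto simp: sample_path_def)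
  then have "(AE x in completion M. continuous_on {0..} (\<lambda>t. X t x)) \<longleftrightarrow>
      (AE x in completion M. continuous_on {0..} (sample_path X x))"
    by simp
  also have "\<dots> \<longleftrightarrow> (AE p in path_law M X. continuous_on {0..} p)"
    unfolding path_law_def using assms
    by (intro AE_distr_iff[symmetric] continuous_paths_in_path_space) (simp add: process_def)
  finally show ?thesis by (simp only: AE_completion_iff)
qed

lemma distr_initial_eq_path_law:
  assumes "process M X"
  shows "distr M borel (X 0) = distr (path_law M X) borel (\<lambda>p. p 0)"
  using path_law_functional[OF assms coordinate_measurable_path_space[of 0]] assms
  by (simp add: sample_path_def process_def)

lemma distr_increments_eq_path_law:
  assumes X: "process M X" and grid: "time_grid n \<tau>"
  shows "distr M (PiM {..<n} (\<lambda>_. borel)) (increments n \<tau> X) =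
    distr (path_law M X) (PiM {..<n} (\<lambda>_. borel)) (increments n \<tau> (\<lambda>t p. p t))"
proof -
  \<comment> \<open>Grid times are nonnegative, so the restriction built into
    \<open>sample_path\<close> is invisible to the increments.\<close>
  have "increments n \<tau> (\<lambda>t p. p t) (sample_path X x) = increments n \<tau> X x" for x
    using time_grid_nonneg[OF grid] by (auto simp: increments_def sample_path_def fun_eq_iff)
  then have eq: "(\<lambda>x. increments n \<tau> (\<lambda>t p. p t) (sample_path X x)) = increments n \<tau> X"
    by (rule ext)
  have "increments n \<tau> X \<in> M \<rightarrow>\<^sub>M PiM {..<n} (\<lambda>_. borel)"
    using X by (intro increments_measurable[OF _ grid]) (simp add: process_def)
  moreover have "increments n \<tau> (\<lambda>t p. p t) \<in> path_space \<rightarrow>\<^sub>M PiM {..<n} (\<lambda>_. borel)"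
    by (intro increments_measurable[OF _ grid] coordinate_measurable_path_space)
  ultimately show ?thesis
    using path_law_functional[OF X, of "increments n \<tau> (\<lambda>t p. p t)"] unfolding eq by blast
qed

section \<open>The direct and the converse part\<close>

lemma standard_BM_of_epi_BM_collection:
  assumes F: "fubini_extension \<Lambda> \<Omega> V" and B: "epi_BM_collection \<Lambda> \<Omega> V B"
  shows "standard_BM V (\<lambda>t (u, \<omega>). B u t \<omega>)"
proof -
  note prob = fubini_extension_prob_spaces[OF F]
  let ?X = "\<lambda>t (u, \<omega>). B u t \<omega>"
  have X: "process V ?X" and BM: "\<And>u. u \<in> space \<Lambda> \<Longrightarrow> standard_BM \<Omega> (B u)"
    using B by (auto simp: epi_BM_collection_def)
  note BM' = BM[unfolded standard_BM_iff_increments[OF prob(2)]]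
  have meas: "?X t \<in> borel_measurable V" if "0 \<le> t" for t
    using X that by (simp add: process_def)
  \<comment> \<open>Every section is a Brownian motion, so the initial law and the increment laws
    below are the same for all \<open>u\<close> and pass to \<open>V\<close>.\<close>
  have "distr V borel (?X 0) = return borel 0"
    using BM' meas[of 0] by (intro fubini_extension_distr_eq[OF F]) auto
  moreover have "distr V (PiM {..<n} (\<lambda>_. borel)) (increments n \<tau> ?X) = increments_law n \<tau>"
    if grid: "time_grid n \<tau>" for n \<tau>
  proof (rule fubini_extension_distr_eq[OF F increments_measurable[OF meas grid]])
    fix u assume u: "u \<in> space \<Lambda>"
    have "(\<lambda>\<omega>. increments n \<tau> ?X (u, \<omega>)) = increments n \<tau> (B u)"
      by (simp add: increments_def fun_eq_iff)
    then show "(\<lambda>\<omega>. increments n \<tau> ?X (u, \<omega>)) \<in> \<Omega> \<rightarrow>\<^sub>M PiM {..<n} (\<lambda>_. borel)"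
      "distr \<Omega> (PiM {..<n} (\<lambda>_. borel)) (\<lambda>\<omega>. increments n \<tau> ?X (u, \<omega>)) = increments_law n \<tau>"
      using BM'[OF u] grid increments_measurable[OF _ grid, of "B u" \<Omega>] by auto
  qed
  moreover have "AE x in V. continuous_on {0..} (\<lambda>t. ?X t x)"
    \<comment> \<open>\<open>process_iff\<close> extracts from \<open>process V\<close> that the
      continuity event is measurable for the completion of \<open>V\<close>.\<close>
    using X BM' by (intro fubini_extension_AE_I[OF F]) (auto simp: process_iff)
  ultimately show ?thesis
    using meas unfolding standard_BM_iff_increments[OF prob(3)] by blast
qed

text \<open>The Fubini property yields continuity only for almost every index, whereas the
  conclusion concerns every \<open>u\<close>. Equality of the path laws closes this gap: one good
  index \<open>v\<close> suffices.\<close>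

lemma epi_BM_collection_of_standard_BM:
  assumes F: "fubini_extension \<Lambda> \<Omega> V" and W: "standard_BM V W"
    and epi: "epi_processes \<Lambda> \<Omega> (\<lambda>u t \<omega>. W t (u, \<omega>))"
    and ident: "identically_distributed_processes \<Lambda> \<Omega> (\<lambda>u t \<omega>. W t (u, \<omega>))"
  shows "epi_BM_collection \<Lambda> \<Omega> V (\<lambda>u t \<omega>. W t (u, \<omega>))"
proof -
  note prob = fubini_extension_prob_spaces[OF F]
  interpret L: prob_space \<Lambda> by (rule prob)
  note W' = W[unfolded standard_BM_iff_increments[OF prob(3)]]
  let ?X = "\<lambda>u t \<omega>. W t (u, \<omega>)"
  have proc: "process \<Omega> (?X u)" if "u \<in> space \<Lambda>" for u
    using ident that by (simp add: identically_distributed_processes_def)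
  have law: "path_law \<Omega> (?X u) = path_law \<Omega> (?X v)" if "u \<in> space \<Lambda>" "v \<in> space \<Lambda>" for u v
    using ident that unfolding identically_distributed_processes_def by blast
  have meas: "?X u t \<in> borel_measurable \<Omega>" if "u \<in> space \<Lambda>" "0 \<le> t" for u t
    using proc that by (simp add: process_def)
  have "AE u in \<Lambda>. AE \<omega> in \<Omega>. continuous_on {0..} (\<lambda>t. W t (u, \<omega>))"
    using W' by (intro fubini_extension_AE_sections[OF F]) simp
  then obtain v where v: "v \<in> space \<Lambda>" "AE \<omega> in \<Omega>. continuous_on {0..} (\<lambda>t. W t (v, \<omega>))"
    using eventually_happens'[OF L.ae_filter_bot eventually_conj[OF AE_space]] by blast
  have "standard_BM \<Omega> (?X u)" if u: "u \<in> space \<Lambda>" for u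
  proof -
    have "AE \<omega> in \<Omega>. continuous_on {0..} (\<lambda>t. W t (u, \<omega>))"
      using v law[OF u v(1)] AE_continuous_iff_path_law[OF proc] u by metis
    \<comment> \<open>Here the common law is that of the fixed section \<open>u\<close>. The
      averaging principle identifies it with the law under \<open>V\<close>, which is known, so the
      section inherits the Brownian law.\<close>
    moreover have "distr V borel (W 0) = distr \<Omega> borel (?X u 0)"
    proof (rule fubini_extension_distr_eq[OF F])
      fix w assume w: "w \<in> space \<Lambda>"
      show "distr \<Omega> borel (?X w 0) = distr \<Omega> borel (?X u 0)"
        unfolding distr_initial_eq_path_law[OF proc[OF w]]
          distr_initial_eq_path_law[OF proc[OF u]] law[OF w u] ..
    qed (use W' meas in auto)
    moreover have "distr V (PiM {..<n} (\<lambda>_. borel)) (increments n \<tau> W) =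
        distr \<Omega> (PiM {..<n} (\<lambda>_. borel)) (increments n \<tau> (?X u))"
      if grid: "time_grid n \<tau>" for n \<tau>
    proof (rule fubini_extension_distr_eq[OF F])
      have eq: "(\<lambda>\<omega>. increments n \<tau> W (w, \<omega>)) = increments n \<tau> (?X w)" for w
        by (simp add: increments_def fun_eq_iff)
      fix w assume w: "w \<in> space \<Lambda>"
      show "(\<lambda>\<omega>. increments n \<tau> W (w, \<omega>)) \<in> \<Omega> \<rightarrow>\<^sub>M PiM {..<n} (\<lambda>_. borel)"
        unfolding eq by (rule increments_measurable[OF meas[OF w] grid])
      show "distr \<Omega> (PiM {..<n} (\<lambda>_. borel)) (\<lambda>\<omega>. increments n \<tau> W (w, \<omega>)) =
          distr \<Omega> (PiM {..<n} (\<lambda>_. borel)) (increments n \<tau> (?X u))"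
        unfolding eq distr_increments_eq_path_law[OF proc[OF w] grid]
          distr_increments_eq_path_law[OF proc[OF u] grid] law[OF w u] ..
    qed (use W' increments_measurable[OF _ grid] in auto)
    ultimately show ?thesis
      unfolding standard_BM_iff_increments[OF prob(2)]
      using W' meas[OF u] by (intro conjI allI impI) auto
  qed
  \<comment> \<open>Joint measurability of the path map comes from the almost sure continuity of
    \<open>W\<close> under \<open>V\<close>, through \<open>processI\<close>.\<close>
  moreover have "process V (\<lambda>t (u, \<omega>). W t (u, \<omega>))"
    using W by (intro processI) (auto simp: standard_BM_def split_beta')
  ultimately show ?thesis using epi by (simp add: epi_BM_collection_def)
qed

theorem theorem2:
  fixes \<Lambda> :: "real measure" and \<Omega> :: "'w measure" and V :: "(real \<times> 'w) measure"
  assumes "lebesgue_extension \<Lambda>"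
    and "fubini_extension \<Lambda> \<Omega> V"
    and "rich_for TYPE('e::polish_space) \<Lambda> \<Omega> V"
  shows "(\<forall>B :: real \<Rightarrow> real \<Rightarrow> 'w \<Rightarrow> real.
            epi_BM_collection \<Lambda> \<Omega> V B \<longrightarrow> standard_BM V (\<lambda>t (u, \<omega>). B u t \<omega>)) \<and>
         (\<forall>W :: real \<Rightarrow> real \<times> 'w \<Rightarrow> real.
            standard_BM V W \<and>
            epi_processes \<Lambda> \<Omega> (\<lambda>u t \<omega>. W t (u, \<omega>)) \<and>
            identically_distributed_processes \<Lambda> \<Omega> (\<lambda>u t \<omega>. W t (u, \<omega>)) \<longrightarrow>
            epi_BM_collection \<Lambda> \<Omega> V (\<lambda>u t \<omega>. W t (u, \<omega>)))"
  using standard_BM_of_epi_BM_collection[OF assms(2)]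
    epi_BM_collection_of_standard_BM[OF assms(2)] by blast

end
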